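(* Let $q\ge 2$ be an integer and $k$ a positive integer, and let $M$ be a matroid with (matroid) tree-width at most $k$ and no minor isomorphic to the uniform matroid $U_{2,2+q}$. Then the characteristic polynomial $\chi_M(\lambda)$ is identically zero or else $\chi_M(\lambda)>0$ for all real $\lambda>\frac{q^k-1}{q-1}$.
   Context: For a loopless matroid $M$ with ground set $E$ and rank function $r$, the characteristic polynomial is $\chi_M(\lambda)=\sum_{F\in L}\mu_M(\emptyset,F)\lambda^{r(E)-r(F)}$, where $L$ is the lattice of flats of $M$ and $\mu_M$ its Möbius function; if $M$ has a loop, $\chi_M(\lambda)$ is defined to be $0$. Matroid tree-width: a tree-decomposition of $M$ is a pair $(T,\tau)$ with $T$ a tree and $\tau:E(M)\to V(T)$ an arbitrary map. For a vertex $v$ of $T$, let $T_1,\dots,T_c$ be the components of $T-v$ and $B_j=\{e\in E(M):\tau(e)\in V(T_j)\}$. The rank defect of a set $B$ is $\mathrm{rd}(B)=r(M)-r(E(M)-B)$. The node width of $v$ is $r(M)-\sum_{j=1}^{c}\mathrm{rd}(B_j)$ (equal to $r(M)$ if $T$ has one vertex). The width of $(T,\tau)$ is the maximum node width over the vertices of $T$, and the tree-width $\mathrm{tw}(M)$ is the minimum width over all tree-decompositions of $M$. *)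

theory Defs
  imports Complex_Main "HOL-Computational_Algebra.Polynomial"
begin

section \<open>Matroids\<close>

record 'a pre_matroid =
  ground :: "'a set"
  indeps :: "'a set set"

locale matroid =
  fixes M :: "'a pre_matroid"
  assumes finite_ground: "finite (ground M)"
    and indeps_subset: "I \<in> indeps M \<Longrightarrow> I \<subseteq> ground M"
    and empty_indep: "{} \<in> indeps M"
    and indep_mono: "I \<in> indeps M \<Longrightarrow> J \<subseteq> I \<Longrightarrow> J \<in> indeps M"
    and augment: "I \<in> indeps M \<Longrightarrow> J \<in> indeps M \<Longrightarrow> card I < card J \<Longrightarrow>
      \<exists>e \<in> J - I. insert e I \<in> indeps M"

definition rk :: "'a pre_matroid \<Rightarrow> 'a set \<Rightarrow> nat" where
  "rk M X = Max (card ` {I \<in> indeps M. I \<subseteq> X})"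

definition is_loop :: "'a pre_matroid \<Rightarrow> 'a \<Rightarrow> bool" where
  "is_loop M e \<longleftrightarrow> e \<in> ground M \<and> {e} \<notin> indeps M"

definition loopless :: "'a pre_matroid \<Rightarrow> bool" where
  "loopless M \<longleftrightarrow> (\<nexists>e. is_loop M e)"

definition flats :: "'a pre_matroid \<Rightarrow> 'a set set" where
  "flats M = {F. F \<subseteq> ground M \<and> (\<forall>e \<in> ground M - F. rk M F < rk M (insert e F))}"


section \<open>Minors, isomorphism and uniform matroids\<close>

definition delete :: "'a pre_matroid \<Rightarrow> 'a set \<Rightarrow> 'a pre_matroid" where
  "delete M D = \<lparr>ground = ground M - D, indeps = {I \<in> indeps M. I \<inter> D = {}}\<rparr>"

text \<open>The matroid \<open>M/C\<close> has rank function \<open>X \<mapsto> r(X \<union> C) - r(C)\<close>, and a set is independent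
  iff its rank equals its cardinality.\<close>

definition contract :: "'a pre_matroid \<Rightarrow> 'a set \<Rightarrow> 'a pre_matroid" where
  "contract M C = \<lparr>ground = ground M - C,
     indeps = {I. I \<subseteq> ground M - C \<and> rk M (I \<union> C) = card I + rk M C}\<rparr>"

definition is_minor :: "'a pre_matroid \<Rightarrow> 'a pre_matroid \<Rightarrow> bool" where
  "is_minor N M \<longleftrightarrow> (\<exists>C D. C \<subseteq> ground M \<and> D \<subseteq> ground M \<and> C \<inter> D = {} \<and>
     N = delete (contract M C) D)"

definition matroid_iso :: "'a pre_matroid \<Rightarrow> 'b pre_matroid \<Rightarrow> bool" where
  "matroid_iso M N \<longleftrightarrow> (\<exists>f. bij_betw f (ground M) (ground N) \<and>
     (\<forall>I \<subseteq> ground M. I \<in> indeps M \<longleftrightarrow> f ` I \<in> indeps N))"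

definition uniform_matroid :: "nat \<Rightarrow> nat \<Rightarrow> nat pre_matroid" where
  "uniform_matroid r n = \<lparr>ground = {..<n}, indeps = {I. I \<subseteq> {..<n} \<and> card I \<le> r}\<rparr>"


section \<open>Moebius function and characteristic polynomial\<close>

text \<open>The Moebius function of the finite poset \<open>P\<close>, with the order of the ambient type.\<close>

function moebius :: "'b::order set \<Rightarrow> 'b \<Rightarrow> 'b \<Rightarrow> int" where
  "moebius P x z =
     (if x = z then 1
      else if finite P \<and> x < z then - (\<Sum>y \<in> {y \<in> P. x \<le> y \<and> y < z}. moebius P x y)
      else 0)"
  by pat_completeness auto
termination
proof (relation "measure (\<lambda>(P, x, z). card {y \<in> P. y < z})")
  fix P :: "'b::order set" and x z y :: 'b
  assume *: "finite P \<and> x < z" "y \<in> {y \<in> P. x \<le> y \<and> y < z}"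
  then have "{w \<in> P. w < y} \<subset> {w \<in> P. w < z}" by force
  with * show "((P, x, y), P, x, z) \<in> measure (\<lambda>(P, x, z). card {y \<in> P. y < z})"
    by (auto intro!: psubset_card_mono)
qed auto

declare moebius.simps [simp del]

definition matroid_charpoly :: "'a pre_matroid \<Rightarrow> real poly" where
  "matroid_charpoly M =
     (if loopless M
      then \<Sum>F \<in> flats M. monom (of_int (moebius (flats M) {} F)) (rk M (ground M) - rk M F)
      else 0)"


section \<open>Trees\<close>

text \<open>A graph is given by its vertex set \<open>V\<close> and its set \<open>E\<close> of two-element edges.
  \<open>walk_rel E S\<close> relates vertices joined by a walk of edges inside \<open>S\<close>.\<close>

definition walk_rel :: "'v set set \<Rightarrow> 'v set \<Rightarrow> ('v \<times> 'v) set" where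
  "walk_rel E S = {(u, v). u \<in> S \<and> v \<in> S \<and> (u, v) \<in> {(x, y). x \<in> S \<and> y \<in> S \<and> {x, y} \<in> E}\<^sup>*}"

definition is_cycle :: "'v set set \<Rightarrow> 'v list \<Rightarrow> bool" where
  "is_cycle E xs \<longleftrightarrow> length xs \<ge> 3 \<and> distinct xs \<and>
     (\<forall>i < length xs. {xs ! i, xs ! (Suc i mod length xs)} \<in> E)"

definition is_tree :: "'v set \<Rightarrow> 'v set set \<Rightarrow> bool" where
  "is_tree V E \<longleftrightarrow> finite V \<and> V \<noteq> {} \<and> E \<subseteq> {e. e \<subseteq> V \<and> card e = 2} \<and>
     (\<forall>u \<in> V. \<forall>v \<in> V. (u, v) \<in> walk_rel E V) \<and> (\<nexists>xs. is_cycle E xs)"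

text \<open>The vertex sets of the components of \<open>T - v\<close>.\<close>

definition components_minus :: "'v set \<Rightarrow> 'v set set \<Rightarrow> 'v \<Rightarrow> 'v set set" where
  "components_minus V E v = (V - {v}) // walk_rel E (V - {v})"


section \<open>Tree-width\<close>

definition rank_defect :: "'a pre_matroid \<Rightarrow> 'a set \<Rightarrow> int" where
  "rank_defect M B = int (rk M (ground M)) - int (rk M (ground M - B))"

definition tree_decomposition ::
    "'a pre_matroid \<Rightarrow> 'v set \<Rightarrow> 'v set set \<Rightarrow> ('a \<Rightarrow> 'v) \<Rightarrow> bool" where
  "tree_decomposition M V E \<tau> \<longleftrightarrow> is_tree V E \<and> \<tau> ` ground M \<subseteq> V"

definition node_width ::
    "'a pre_matroid \<Rightarrow> 'v set \<Rightarrow> 'v set set \<Rightarrow> ('a \<Rightarrow> 'v) \<Rightarrow> 'v \<Rightarrow> int" where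
  "node_width M V E \<tau> v = int (rk M (ground M)) -
     (\<Sum>C \<in> components_minus V E v. rank_defect M {e \<in> ground M. \<tau> e \<in> C})"

definition decomposition_width ::
    "'a pre_matroid \<Rightarrow> 'v set \<Rightarrow> 'v set set \<Rightarrow> ('a \<Rightarrow> 'v) \<Rightarrow> int" where
  "decomposition_width M V E \<tau> = Max (node_width M V E \<tau> ` V)"

text \<open>Trees are finite, so vertices may be taken to be natural numbers. The infimum
  is a minimum, see \<open>tree_width_attained\<close> and \<open>tree_width_le\<close> below.\<close>

definition tree_widths :: "'a pre_matroid \<Rightarrow> int set" where
  "tree_widths M = {decomposition_width M V E \<tau> | (V :: nat set) E \<tau>. tree_decomposition M V E \<tau>}"

definition tree_width :: "'a pre_matroid \<Rightarrow> int" where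
  "tree_width M = Inf (tree_widths M)"

lemma (in matroid) finite_indeps: "finite (indeps M)"
  by (rule finite_subset[of _ "Pow (ground M)"]) (use finite_ground indeps_subset in auto)

lemma (in matroid) rank_defect_le_card:
  assumes "B \<subseteq> ground M"
  shows "rank_defect M B \<le> int (card B)"
proof -
  have "rk M (ground M) \<in> card ` {I \<in> indeps M. I \<subseteq> ground M}"
    unfolding rk_def using finite_indeps empty_indep by (intro Max_in) auto
  then obtain I where I: "I \<in> indeps M" "card I = rk M (ground M)" by auto
  have finB: "finite B" using assms finite_ground finite_subset by blast
  have "I - B \<in> indeps M" "I - B \<subseteq> ground M - B"
    using I indep_mono indeps_subset by auto
  then have "card (I - B) \<le> rk M (ground M - B)"
    unfolding rk_def using finite_indeps by (intro Max_ge) auto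
  moreover have "card I - card B \<le> card (I - B)" using finB by (rule diff_card_le_card_Diff)
  ultimately show ?thesis using I unfolding rank_defect_def by linarith
qed

lemma equiv_walk_rel: "equiv S (walk_rel E S)"
proof (rule equivI)
  let ?r = "{(x, y). x \<in> S \<and> y \<in> S \<and> {x, y} \<in> E}"
  show "walk_rel E S \<subseteq> S \<times> S" by (auto simp: walk_rel_def)
  show "refl_on S (walk_rel E S)" by (auto simp: walk_rel_def refl_on_def)
  have "sym ?r" by (auto simp: sym_def insert_commute)
  then have "sym (?r\<^sup>*)" by (rule sym_rtrancl)
  then show "sym (walk_rel E S)" by (auto simp: walk_rel_def sym_def)
  show "trans (walk_rel E S)" by (auto simp: walk_rel_def trans_def)
qed

lemma (in matroid) node_width_ge:
  assumes "finite V"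
  shows "node_width M V E \<tau> v \<ge> - int (card (ground M))"
proof -
  let ?C = "components_minus V E v"
  let ?B = "\<lambda>C. {e \<in> ground M. \<tau> e \<in> C}"
  have eq: "equiv (V - {v}) (walk_rel E (V - {v}))" by (rule equiv_walk_rel)
  have finC: "finite ?C" unfolding components_minus_def
    by (rule finite_quotient) (use assms in \<open>auto simp: walk_rel_def\<close>)
  have "(\<Sum>C \<in> ?C. rank_defect M (?B C)) \<le> (\<Sum>C \<in> ?C. int (card (?B C)))"
    by (intro sum_mono rank_defect_le_card) auto
  also have "\<dots> = int (\<Sum>C \<in> ?C. card (?B C))" by simp
  also have "(\<Sum>C \<in> ?C. card (?B C)) = card (\<Union>C \<in> ?C. ?B C)"
  proof (rule card_UN_disjoint[symmetric])
    show "\<forall>C \<in> ?C. \<forall>D \<in> ?C. C \<noteq> D \<longrightarrow> ?B C \<inter> ?B D = {}"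
      using quotient_disj[OF eq] unfolding components_minus_def by blast
  qed (use finC finite_ground in auto)
  also have "\<dots> \<le> int (card (ground M))"
    using finite_ground by (auto intro!: card_mono)
  finally show ?thesis unfolding node_width_def by linarith
qed

lemma (in matroid) tree_widths_bdd_below: "bdd_below (tree_widths M)"
proof (rule bdd_belowI[of _ "- int (card (ground M))"])
  fix w assume "w \<in> tree_widths M"
  then obtain V :: "nat set" and E \<tau> where w: "w = Max (node_width M V E \<tau> ` V)"
    and t: "is_tree V E"
    by (auto simp: tree_widths_def tree_decomposition_def decomposition_width_def)
  then obtain v where "v \<in> V" "finite V" by (auto simp: is_tree_def)
  then have "node_width M V E \<tau> v \<le> w" unfolding w by auto
  with node_width_ge[OF \<open>finite V\<close>] show "- int (card (ground M)) \<le> w" by (rule order_trans)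
qed

lemma tree_widths_nonempty: "tree_widths M \<noteq> {}"
proof -
  have "is_tree {0 :: nat} {}"
    by (auto simp: is_tree_def is_cycle_def walk_rel_def) force
  then have "tree_decomposition M {0 :: nat} {} (\<lambda>_. 0)"
    by (auto simp: tree_decomposition_def)
  then show ?thesis unfolding tree_widths_def by blast
qed

lemma (in matroid) tree_width_le: "w \<in> tree_widths M \<Longrightarrow> tree_width M \<le> w"
  unfolding tree_width_def using tree_widths_bdd_below by (rule cInf_lower[rotated])

lemma (in matroid) tree_width_attained: "tree_width M \<in> tree_widths M"
proof -
  have "Inf (tree_widths M) < tree_width M + 1" by (simp add: tree_width_def)
  then obtain w where w: "w \<in> tree_widths M" "w < tree_width M + 1"
    using cInf_lessD[OF tree_widths_nonempty] by blast
  with tree_width_le have "w = tree_width M" by fastforce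
  with w show ?thesis by simp
qed

end

theory Submission
  imports Defs "HOL-Library.Disjoint_Sets" "HOL-Library.Transitive_Closure_Table"
begin

text \<open>A matroid of tree-width at most \<open>k\<close> has a set \<open>B\<close> of rank at most \<open>k\<close> whose complement is
  not spanning, so \<open>B\<close> contains a cocircuit. If the matroid is simple without a
  \<open>U(2, q + 2)\<close>-minor, Kung's bound gives \<open>card B \<le> d = (q ^ k - 1) / (q - 1)\<close>. Deletion and
  contraction of the elements of this cocircuit bound the characteristic polynomial at \<open>x\<close> from
  below by \<open>x - d\<close> times that of a hyperplane, provided that it is nonnegative on proper
  minors. The class in question is minor-closed, parallel elements do not change the polynomial, and
  loops make it vanish; so induction gives positivity for \<open>x > d\<close>. All minors are
  represented by their rank functions, and the polynomial by Whitney's subset expansion.\<close>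

section \<open>Rank functions\<close>

locale rank_function =
  fixes r :: "'a set \<Rightarrow> nat"
  assumes rank_empty: "r {} = 0"
    and rank_singleton_le: "r {e} \<le> 1"
    and rank_mono: "X \<subseteq> Y \<Longrightarrow> r X \<le> r Y"
    and rank_submodular: "r (X \<union> Y) + r (X \<inter> Y) \<le> r X + r Y"
begin

lemma rank_insert_le: "r (insert e X) \<le> Suc (r X)"
  using rank_submodular[of "{e}" X] rank_singleton_le[of e] by simp

lemma rank_insert_ge: "r X \<le> r (insert e X)"
  by (rule rank_mono) auto

lemma rank_insert_eq_mono:
  assumes "r (insert e X) = r X" "X \<subseteq> Z"
  shows "r (insert e Z) = r Z"
proof -
  have "insert e X \<union> Z = insert e Z" "X \<subseteq> insert e X \<inter> Z" using assms(2) by auto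
  then have "r (insert e Z) + r X \<le> r (insert e X) + r Z"
    using rank_submodular[of "insert e X" Z] rank_mono[of X "insert e X \<inter> Z"] by simp
  then show ?thesis using assms(1) rank_insert_ge[of Z e] by simp
qed

lemma rank_Un_eq:
  assumes "finite S" "\<And>a. a \<in> S \<Longrightarrow> r (insert a X) = r X"
  shows "r (S \<union> X) = r X"
  using assms
proof (induction S rule: finite_induct)
  case (insert a S)
  then show ?case using rank_insert_eq_mono[of a X "S \<union> X"] by simp
qed simp

end

definition loopless_on :: "('a set \<Rightarrow> nat) \<Rightarrow> 'a set \<Rightarrow> bool" where
  "loopless_on r A \<longleftrightarrow> (\<forall>a \<in> A. r {a} = 1)"

definition simple_on :: "('a set \<Rightarrow> nat) \<Rightarrow> 'a set \<Rightarrow> bool" where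
  "simple_on r A \<longleftrightarrow> loopless_on r A \<and> pairwise (\<lambda>a b. r {a, b} = 2) A"

lemma loopless_on_subset: "loopless_on r A \<Longrightarrow> B \<subseteq> A \<Longrightarrow> loopless_on r B"
  by (auto simp: loopless_on_def)

lemma simple_on_subset: "simple_on r A \<Longrightarrow> B \<subseteq> A \<Longrightarrow> simple_on r B"
  using loopless_on_subset pairwise_subset by (auto simp: simple_on_def)

lemma (in rank_function) rank_pair_eq_1_or_2:
  assumes "r {a} = 1" "r {b} = 1"
  shows "r {a, b} = 1 \<or> r {a, b} = 2"
  using rank_insert_le[of a "{b}"] rank_insert_ge[of "{b}" a] assms by auto

lemma (in rank_function) ex_simplification:
  assumes "finite A" "loopless_on r A"
  obtains B where "B \<subseteq> A" "simple_on r B" "\<And>a. a \<in> A \<Longrightarrow> \<exists>b \<in> B. r {a, b} = 1"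
proof -
  have "\<exists>B \<subseteq> A. simple_on r B \<and> (\<forall>a \<in> A. \<exists>b \<in> B. r {a, b} = 1)"
    using assms
  proof (induction A rule: finite_induct)
    case empty
    then show ?case by (simp add: simple_on_def)
  next
    case (insert a A)
    then obtain B where B: "B \<subseteq> A" "simple_on r B" "\<forall>a \<in> A. \<exists>b \<in> B. r {a, b} = 1"
      using loopless_on_subset[of r "insert a A" A] by blast
    show ?case
    proof (cases "\<exists>b \<in> B. r {a, b} = 1")
      case True
      then show ?thesis using B by blast
    next
      case False
      have "r {a, b} = 2" if "b \<in> B" for b
        using False that rank_pair_eq_1_or_2[of a b] insert.prems B(1)
        by (auto simp: loopless_on_def)
      then have "simple_on r (insert a B)"
        using B insert.prems
        by (auto simp: simple_on_def loopless_on_def pairwise_insert insert_commute)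
      moreover have "r {a, a} = 1" using insert.prems by (simp add: loopless_on_def)
      ultimately show ?thesis using B by (intro exI[of _ "insert a B"]) blast
    qed
  qed
  then show ?thesis using that by blast
qed

definition contract_rank :: "('a set \<Rightarrow> nat) \<Rightarrow> 'a set \<Rightarrow> 'a set \<Rightarrow> nat" where
  "contract_rank r C X = r (X \<union> C) - r C"

context rank_function
begin

lemma contract_rank_empty: "contract_rank r {} = r"
  by (auto simp: contract_rank_def rank_empty)

lemma rank_function_contract: "rank_function (contract_rank r C)"
proof
  show "contract_rank r C {} = 0" by (simp add: contract_rank_def)
  show "contract_rank r C {e} \<le> 1" for e
    using rank_insert_le[of e C] by (simp add: contract_rank_def)
  show "contract_rank r C X \<le> contract_rank r C Y" if "X \<subseteq> Y" for X Y
    unfolding contract_rank_def by (intro diff_le_mono rank_mono) (use that in auto)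
  show "contract_rank r C (X \<union> Y) + contract_rank r C (X \<inter> Y)
      \<le> contract_rank r C X + contract_rank r C Y" for X Y
  proof -
    have "(X \<union> C) \<union> (Y \<union> C) = X \<union> Y \<union> C" "(X \<union> C) \<inter> (Y \<union> C) = X \<inter> Y \<union> C" by auto
    then have "r (X \<union> Y \<union> C) + r (X \<inter> Y \<union> C) \<le> r (X \<union> C) + r (Y \<union> C)"
      using rank_submodular[of "X \<union> C" "Y \<union> C"] by simp
    moreover have "r C \<le> r (X \<inter> Y \<union> C)" "r C \<le> r (X \<union> Y \<union> C)" "r C \<le> r (X \<union> C)" "r C \<le> r (Y \<union> C)"
      by (auto intro: rank_mono)
    ultimately show ?thesis unfolding contract_rank_def by linarith
  qed
qed

lemma contract_rank_contract_rank:
  "contract_rank (contract_rank r C) D = contract_rank r (C \<union> D)"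
proof
  fix X
  have "r C \<le> r (D \<union> C)" by (auto intro: rank_mono)
  then show "contract_rank (contract_rank r C) D X = contract_rank r (C \<union> D) X"
    by (simp add: contract_rank_def Un_ac)
qed

lemma contract_rank_coloop:
  assumes "r (insert e A) \<noteq> r A" "X \<subseteq> A"
  shows "contract_rank r {e} X = r X"
proof -
  have "r (insert e Y) = Suc (r Y)" if "Y \<subseteq> A" for Y
    using rank_insert_eq_mono[of e Y A] rank_insert_le[of e Y] rank_insert_ge[of Y e] assms(1) that
    by linarith
  from this[of X] this[of "{}"] show ?thesis
    using assms(2) rank_empty by (simp add: contract_rank_def)
qed

end

definition hyperplane :: "('a set \<Rightarrow> nat) \<Rightarrow> 'a set \<Rightarrow> 'a set \<Rightarrow> bool" where
  "hyperplane r A H \<longleftrightarrow> H \<subseteq> A \<and> r H < r A \<and> (\<forall>e \<in> A - H. r (insert e H) = r A)"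

context rank_function
begin

lemma rank_hyperplane_Un:
  assumes "hyperplane r A H" "D \<subseteq> A - H" "D \<noteq> {}"
  shows "r (H \<union> D) = r A"
proof -
  obtain e where "e \<in> D" using assms(3) by blast
  then have "r A = r (insert e H)" using assms(1,2) by (auto simp: hyperplane_def)
  moreover have "r (insert e H) \<le> r (H \<union> D)" "r (H \<union> D) \<le> r A"
    by (rule rank_mono; use \<open>e \<in> D\<close> assms in \<open>auto simp: hyperplane_def\<close>)+
  ultimately show ?thesis by simp
qed

lemma ex_hyperplane_above:
  assumes "finite A" "B \<subseteq> A" "r B < r A"
  obtains H where "hyperplane r A H" "B \<subseteq> H"
proof -
  let ?S = "{H. H \<subseteq> A \<and> r H < r A}"
  have "finite ?S" by (rule finite_subset[of _ "Pow A"]) (use assms in auto)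
  then obtain H where H: "H \<in> ?S" "B \<subseteq> H" and maximal: "\<And>H'. H' \<in> ?S \<Longrightarrow> H \<subseteq> H' \<Longrightarrow> H = H'"
    using finite_has_maximal2[of ?S B] assms by auto
  have "r (insert e H) = r A" if e: "e \<in> A - H" for e
  proof (rule ccontr)
    assume "r (insert e H) \<noteq> r A"
    moreover have "r (insert e H) \<le> r A" by (rule rank_mono) (use H e in auto)
    ultimately have "H = insert e H" by (intro maximal) (use H e in auto)
    then show False using e by auto
  qed
  then have "hyperplane r A H" using H(1) by (simp add: hyperplane_def)
  then show ?thesis using that H(2) by blast
qed

end


section \<open>The Whitney sum\<close>

definition whitney_sum :: "('a set \<Rightarrow> nat) \<Rightarrow> 'a set \<Rightarrow> 'b::comm_ring_1 \<Rightarrow> 'b" where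
  "whitney_sum r A x = (\<Sum>X \<in> Pow A. (-1) ^ card X * x ^ (r A - r X))"

lemma whitney_sum_cong:
  assumes "\<And>X. X \<subseteq> A \<Longrightarrow> r X = s X"
  shows "whitney_sum r A x = whitney_sum s A x"
  unfolding whitney_sum_def by (rule sum.cong) (use assms in auto)

context rank_function
begin

lemma whitney_sum_insert:
  assumes "finite A" "e \<notin> A"
  shows "whitney_sum r (insert e A) x =
    x ^ (r (insert e A) - r A) * whitney_sum r A x - whitney_sum (contract_rank r {e}) A x"
proof -
  let ?f = "\<lambda>X. (-1) ^ card X * x ^ (r (insert e A) - r X)"
  have "whitney_sum r (insert e A) x = sum ?f (Pow A) + sum ?f (insert e ` Pow A)"
    unfolding whitney_sum_def Pow_insert
    by (rule sum.union_disjoint) (use assms in auto)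
  also have "sum ?f (Pow A) = x ^ (r (insert e A) - r A) * whitney_sum r A x"
    unfolding whitney_sum_def sum_distrib_left
  proof (rule sum.cong)
    fix X assume "X \<in> Pow A"
    then have "r X \<le> r A" "r A \<le> r (insert e A)" by (auto intro: rank_mono)
    then have "r (insert e A) - r X = (r (insert e A) - r A) + (r A - r X)" by simp
    then show "?f X = x ^ (r (insert e A) - r A) * ((-1) ^ card X * x ^ (r A - r X))"
      by (simp add: power_add mult_ac)
  qed simp
  also have "sum ?f (insert e ` Pow A) = (\<Sum>X \<in> Pow A. ?f (insert e X))"
    by (subst sum.reindex) (use assms in \<open>auto simp: inj_on_def\<close>)
  also have "\<dots> = - whitney_sum (contract_rank r {e}) A x"
    unfolding whitney_sum_def sum_negf[symmetric]
  proof (rule sum.cong)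
    fix X assume X: "X \<in> Pow A"
    then have "finite X" "e \<notin> X" using assms finite_subset by auto
    moreover have "r {e} \<le> r (insert e X)" by (auto intro: rank_mono)
    ultimately show "?f (insert e X) = - ((-1) ^ card X *
        x ^ (contract_rank r {e} A - contract_rank r {e} X))"
      by (simp add: contract_rank_def)
  qed simp
  finally show ?thesis by simp
qed

corollary whitney_sum_insert_spanned:
  assumes "finite A" "e \<notin> A" "r (insert e A) = r A"
  shows "whitney_sum r (insert e A) x = whitney_sum r A x - whitney_sum (contract_rank r {e}) A x"
  using whitney_sum_insert[OF assms(1,2)] assms(3) by simp

corollary whitney_sum_insert_coloop:
  assumes "finite A" "e \<notin> A" "r (insert e A) \<noteq> r A"
  shows "whitney_sum r (insert e A) x = (x - 1) * whitney_sum r A x"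
proof -
  have "r (insert e A) - r A = 1"
    using rank_insert_le[of e A] rank_insert_ge[of A e] assms(3) by simp
  moreover have "whitney_sum (contract_rank r {e}) A x = whitney_sum r A x"
    by (rule whitney_sum_cong) (rule contract_rank_coloop[OF assms(3)])
  ultimately show ?thesis using whitney_sum_insert[OF assms(1,2), of x] by (simp add: algebra_simps)
qed

lemma whitney_sum_loop:
  assumes "finite A" "e \<in> A" "r {e} = 0"
  shows "whitney_sum r A x = 0"
proof -
  have spanned: "r (insert e X) = r X" for X
    using rank_insert_eq_mono[of e "{}" X] assms(3) rank_empty by simp
  have "whitney_sum (contract_rank r {e}) (A - {e}) x = whitney_sum r (A - {e}) x"
    by (rule whitney_sum_cong) (simp add: contract_rank_def spanned assms(3) rank_empty)
  then show ?thesis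
    using whitney_sum_insert_spanned[of "A - {e}" e x] spanned[of "A - {e}"] assms(1,2)
    by (simp add: insert_absorb)
qed

corollary whitney_sum_not_loopless:
  assumes "finite A" "\<not> loopless_on r A"
  shows "whitney_sum r A x = 0"
proof -
  obtain e where "e \<in> A" "r {e} \<noteq> 1" using assms(2) by (auto simp: loopless_on_def)
  then show ?thesis
    using whitney_sum_loop[of A e] rank_singleton_le[of e] assms(1) by simp
qed

lemma whitney_sum_delete_parallel:
  assumes "finite A" "a \<in> A" "b \<in> A" "a \<noteq> b" "r {a, b} = r {a}" "r {a, b} = r {b}"
  shows "whitney_sum r A x = whitney_sum r (A - {b}) x"
proof -
  have "r (insert b (A - {b})) = r (A - {b})"
    by (rule rank_insert_eq_mono[of b "{a}"]) (use assms in \<open>auto simp: insert_commute\<close>)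
  moreover have "whitney_sum (contract_rank r {b}) (A - {b}) x = 0"
    by (rule rank_function.whitney_sum_loop[OF rank_function_contract, where e = a])
      (use assms in \<open>auto simp: contract_rank_def insert_commute\<close>)
  ultimately show ?thesis
    using whitney_sum_insert_spanned[of "A - {b}" b x] assms(1,3) by (simp add: insert_absorb)
qed

lemma whitney_sum_contract_le_hyperplane:
  fixes x :: "'b::linordered_idom"
  assumes "finite A" and H: "hyperplane r A H" and e: "e \<in> A - H" and D: "D \<subseteq> A - H - {e}"
    and nonneg: "\<And>f D. f \<in> A - H - {e} \<Longrightarrow> D \<subseteq> A - H - {e, f} \<Longrightarrow>
      0 \<le> whitney_sum (contract_rank r {e, f}) (H \<union> D) x"
  shows "whitney_sum (contract_rank r {e}) (H \<union> D) x \<le> whitney_sum r H x"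
proof -
  let ?s = "contract_rank r {e}"
  interpret s: rank_function ?s by (rule rank_function_contract)
  have "D \<subseteq> A" "H \<subseteq> A" using D H by (auto simp: hyperplane_def)
  then have "finite D" "finite H" using \<open>finite A\<close> finite_subset by blast+
  from \<open>finite D\<close> show ?thesis using D
  proof (induction D rule: finite_induct)
    case empty
    have "r (insert e H) \<noteq> r H" using H e by (auto simp: hyperplane_def)
    then have "whitney_sum ?s H x = whitney_sum r H x"
      by (intro whitney_sum_cong contract_rank_coloop)
    then show ?case by simp
  next
    case (insert f D)
    have "r (H \<union> insert e D) = r A" "r (H \<union> insert e (insert f D)) = r A"
      by (rule rank_hyperplane_Un[OF H]; use insert.prems e in blast)+
    then have "?s (insert f (H \<union> D)) = ?s (H \<union> D)"
      by (simp add: contract_rank_def insert_commute)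
    moreover have "f \<notin> H \<union> D" using insert by auto
    ultimately have "whitney_sum ?s (insert f (H \<union> D)) x =
        whitney_sum ?s (H \<union> D) x - whitney_sum (contract_rank ?s {f}) (H \<union> D) x"
      using \<open>finite H\<close> \<open>finite D\<close> insert.hyps by (intro s.whitney_sum_insert_spanned) auto
    moreover have "contract_rank ?s {f} = contract_rank r {e, f}"
      by (simp add: contract_rank_contract_rank insert_commute)
    moreover have "0 \<le> whitney_sum (contract_rank r {e, f}) (H \<union> D) x"
      by (rule nonneg) (use insert in auto)
    ultimately show ?case using insert by simp
  qed
qed

text \<open>Adding the elements of the cocircuit \<open>A - H\<close> back to \<open>H\<close> one at a time, the first
  acts as a coloop (factor \<open>x - 1\<close>), and every further one costs at most one more
  copy of the Whitney sum of \<open>H\<close>.\<close>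

lemma whitney_sum_ge_hyperplane:
  fixes x :: "'b::linordered_idom"
  assumes "finite A" and H: "hyperplane r A H"
    and nonneg: "\<And>e f D. e \<in> A - H \<Longrightarrow> f \<in> A - H - {e} \<Longrightarrow> D \<subseteq> A - H - {e, f} \<Longrightarrow>
      0 \<le> whitney_sum (contract_rank r {e, f}) (H \<union> D) x"
  shows "(x - of_nat (card (A - H))) * whitney_sum r H x \<le> whitney_sum r A x"
proof -
  have "finite H" using H \<open>finite A\<close> finite_subset by (auto simp: hyperplane_def)
  have "(x - of_nat (card D)) * whitney_sum r H x \<le> whitney_sum r (H \<union> D) x"
    if "finite D" "D \<noteq> {}" "D \<subseteq> A - H" for D
    using that
  proof (induction D rule: finite_ne_induct)
    case (singleton e)
    then have "r (insert e H) \<noteq> r H" "e \<notin> H" using H by (auto simp: hyperplane_def)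
    then show ?case using whitney_sum_insert_coloop[of H e x] \<open>finite H\<close> by simp
  next
    case (insert e D)
    have "r (insert e (H \<union> D)) = r (H \<union> D)"
      using rank_hyperplane_Un[OF H, of D] rank_hyperplane_Un[OF H, of "insert e D"] insert by simp
    then have "whitney_sum r (insert e (H \<union> D)) x =
        whitney_sum r (H \<union> D) x - whitney_sum (contract_rank r {e}) (H \<union> D) x"
      using insert \<open>finite H\<close> by (intro whitney_sum_insert_spanned) auto
    moreover have "whitney_sum (contract_rank r {e}) (H \<union> D) x \<le> whitney_sum r H x"
      by (rule whitney_sum_contract_le_hyperplane[OF \<open>finite A\<close> H _ _ nonneg]) (use insert in auto)
    moreover have "(x - of_nat (card D)) * whitney_sum r H x \<le> whitney_sum r (H \<union> D) x"
      using insert by simp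
    ultimately show ?case using insert.hyps by (simp add: algebra_simps)
  qed
  moreover have "H \<union> (A - H) = A" "A - H \<noteq> {}" using H by (auto simp: hyperplane_def)
  ultimately show ?thesis using \<open>finite A\<close> by (metis finite_Diff order_refl)
qed

end


section \<open>Minor-closed classes\<close>

locale minor_closed_class =
  fixes K :: "('a set \<Rightarrow> nat) \<Rightarrow> 'a set \<Rightarrow> bool"
  assumes member_rank_function: "K r A \<Longrightarrow> rank_function r"
    and member_finite: "K r A \<Longrightarrow> finite A"
    and member_delete: "K r A \<Longrightarrow> e \<in> A \<Longrightarrow> K r (A - {e})"
    and member_contract: "K r A \<Longrightarrow> e \<in> A \<Longrightarrow> K (contract_rank r {e}) (A - {e})"
begin

lemma member_subset:
  assumes "K r A" "B \<subseteq> A"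
  shows "K r B"
proof -
  have "K r (A - D)" if "finite D" for D
    using that
  proof (induction D rule: finite_induct)
    case (insert e D)
    have "A - insert e D = A - D - {e}" by auto
    then show ?case using member_delete[of r "A - D" e] insert.IH by (cases "e \<in> A - D") auto
  qed (use assms in simp)
  from this[of "A - B"] show ?thesis using assms member_finite by (simp add: double_diff)
qed

lemma member_contract_pair:
  assumes "K r A" "e \<in> A" "f \<in> A" "e \<noteq> f" "B \<subseteq> A - {e, f}"
  shows "K (contract_rank r {e, f}) B"
proof -
  interpret rank_function r using assms(1) by (rule member_rank_function)
  have "K (contract_rank (contract_rank r {e}) {f}) (A - {e} - {f})"
    using assms by (intro member_contract) auto
  then have "K (contract_rank r {e, f}) (A - {e} - {f})"
    by (simp add: contract_rank_contract_rank insert_commute)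
  then show ?thesis by (rule member_subset) (use assms(5) in auto)
qed

lemma whitney_sum_pos_of_hyperplane:
  fixes x :: "'b::linordered_idom"
  assumes "K r A" and H: "hyperplane r A H" and "of_nat (card (A - H)) < x"
    and "0 < whitney_sum r H x"
    and nonneg: "\<And>s B. K s B \<Longrightarrow> card B < card A \<Longrightarrow> 0 \<le> whitney_sum s B x"
  shows "0 < whitney_sum r A x"
proof -
  interpret rank_function r using assms(1) by (rule member_rank_function)
  have "finite A" using assms(1) by (rule member_finite)
  have "(x - of_nat (card (A - H))) * whitney_sum r H x \<le> whitney_sum r A x"
  proof (rule whitney_sum_ge_hyperplane[OF \<open>finite A\<close> H], rule nonneg)
    fix e f D assume efD: "e \<in> A - H" "f \<in> A - H - {e}" "D \<subseteq> A - H - {e, f}"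
    have "H \<subseteq> A" using H by (simp add: hyperplane_def)
    then show "K (contract_rank r {e, f}) (H \<union> D)"
      using efD assms(1) by (intro member_contract_pair) auto
    show "card (H \<union> D) < card A"
      by (rule psubset_card_mono) (use efD \<open>H \<subseteq> A\<close> \<open>finite A\<close> in auto)
  qed
  moreover have "0 < (x - of_nat (card (A - H))) * whitney_sum r H x"
    using assms(3,4) by simp
  ultimately show ?thesis by (rule less_le_trans[rotated])
qed

theorem whitney_sum_pos:
  fixes x :: "'b::linordered_idom"
  assumes small_cocircuit: "\<And>r A. K r A \<Longrightarrow> simple_on r A \<Longrightarrow> A \<noteq> {} \<Longrightarrow>
      \<exists>H. hyperplane r A H \<and> of_nat (card (A - H)) < x"
    and "K r A" "loopless_on r A"
  shows "0 < whitney_sum r A x"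
  using assms(2,3)
proof (induction "card A" arbitrary: r A rule: less_induct)
  case less
  interpret rank_function r using less.prems(1) by (rule member_rank_function)
  have "finite A" using less.prems(1) by (rule member_finite)
  have pos: "0 < whitney_sum r B x" if "B \<subset> A" for B
    using less.hyps[OF psubset_card_mono[OF \<open>finite A\<close> that]] that
      member_subset[OF less.prems(1)] loopless_on_subset[OF less.prems(2)] by blast
  consider (empty) "A = {}" | (simple) "simple_on r A" "A \<noteq> {}"
    | (parallel) a b where "a \<in> A" "b \<in> A" "a \<noteq> b" "r {a, b} \<noteq> 2"
    using less.prems(2) by (auto simp: simple_on_def pairwise_def)
  then show ?case
  proof cases
    case empty
    then show ?thesis by (simp add: whitney_sum_def)
  next
    case parallel
    then have "r {a} = 1" "r {b} = 1" "r {a, b} = 1"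
      using rank_pair_eq_1_or_2[of a b] less.prems(2) by (auto simp: loopless_on_def)
    then have "whitney_sum r A x = whitney_sum r (A - {b}) x"
      using parallel \<open>finite A\<close> by (intro whitney_sum_delete_parallel) auto
    then show ?thesis using pos[of "A - {b}"] parallel(2) by auto
  next
    case simple
    then obtain H where H: "hyperplane r A H" "of_nat (card (A - H)) < x"
      using small_cocircuit less.prems(1) by blast
    then have "H \<subset> A" by (auto simp: hyperplane_def)
    have "0 \<le> whitney_sum s B x" if "K s B" "card B < card A" for s B
      using less.hyps[of B s] that member_finite member_rank_function
        rank_function.whitney_sum_not_loopless[of s B x]
      by (cases "loopless_on s B") auto
    then show ?thesis
      using whitney_sum_pos_of_hyperplane[OF less.prems(1) H pos[OF \<open>H \<subset> A\<close>]] by blast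
  qed
qed

end


section \<open>Excluded uniform minors and Kung's bound\<close>

definition uniform_on :: "('a set \<Rightarrow> nat) \<Rightarrow> nat \<Rightarrow> 'a set \<Rightarrow> bool" where
  "uniform_on r n S \<longleftrightarrow> (\<forall>X \<subseteq> S. r X = min (card X) n)"

definition no_uniform_minor :: "nat \<Rightarrow> nat \<Rightarrow> ('a set \<Rightarrow> nat) \<Rightarrow> 'a set \<Rightarrow> bool" where
  "no_uniform_minor n m r A \<longleftrightarrow>
     (\<forall>C S. C \<subseteq> A \<and> S \<subseteq> A - C \<and> card S = m \<longrightarrow> \<not> uniform_on (contract_rank r C) n S)"

lemma no_uniform_minor_subset:
  assumes "no_uniform_minor n m r A" "B \<subseteq> A"
  shows "no_uniform_minor n m r B"
  unfolding no_uniform_minor_def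
proof (intro allI impI, elim conjE)
  fix C S assume "C \<subseteq> B" "S \<subseteq> B - C" "card S = m"
  then have "C \<subseteq> A" "S \<subseteq> A - C" "card S = m" using assms(2) by auto
  then show "\<not> uniform_on (contract_rank r C) n S"
    using assms(1) unfolding no_uniform_minor_def by blast
qed

context rank_function
begin

lemma no_uniform_minor_contract:
  assumes "no_uniform_minor n m r A" "e \<in> A"
  shows "no_uniform_minor n m (contract_rank r {e}) (A - {e})"
  unfolding no_uniform_minor_def contract_rank_contract_rank
proof (intro allI impI, elim conjE)
  fix C S assume "C \<subseteq> A - {e}" "S \<subseteq> A - {e} - C" "card S = m"
  then have "{e} \<union> C \<subseteq> A" "S \<subseteq> A - ({e} \<union> C)" "card S = m" using assms(2) by auto
  then show "\<not> uniform_on (contract_rank r ({e} \<union> C)) n S"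
    using assms(1) unfolding no_uniform_minor_def by blast
qed

lemma uniform_on_line:
  assumes "finite S" "simple_on r S" "r S \<le> 2"
  shows "uniform_on r 2 S"
  unfolding uniform_on_def
proof (intro allI impI)
  fix X assume X: "X \<subseteq> S"
  then have "finite X" using \<open>finite S\<close> finite_subset by blast
  consider (empty) "X = {}" | (point) a where "X = {a}"
    | (pair) a b where "a \<in> X" "b \<in> X" "a \<noteq> b" by blast
  then show "r X = min (card X) 2"
  proof cases
    case empty
    then show ?thesis using rank_empty by simp
  next
    case point
    then show ?thesis using X assms(2) by (simp add: simple_on_def loopless_on_def)
  next
    case pair
    then have "r {a, b} \<le> r X" "card {a, b} \<le> card X"
      using \<open>finite X\<close> by (intro rank_mono card_mono; simp)+
    moreover have "r {a, b} = 2" using pair X assms(2) by (auto simp: simple_on_def pairwise_def)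
    moreover have "r X \<le> r S" using X by (rule rank_mono)
    ultimately show ?thesis using pair assms(3) by simp
  qed
qed

lemma card_line_le:
  assumes "finite S" "simple_on r S" "r S \<le> 2" "no_uniform_minor 2 (Suc m) r S"
  shows "card S \<le> m"
proof (rule ccontr)
  assume "\<not> card S \<le> m"
  then obtain T where T: "T \<subseteq> S" "card T = Suc m" "finite T"
    using obtain_subset_with_card_n[of "Suc m" S] by auto
  have "r T \<le> 2" using rank_mono[OF T(1)] assms(3) by simp
  then have "uniform_on r 2 T"
    using T simple_on_subset[OF assms(2)] by (intro uniform_on_line)
  moreover have "\<not> uniform_on (contract_rank r {}) 2 T"
    using assms(4) T unfolding no_uniform_minor_def by blast
  ultimately show False by (simp add: contract_rank_empty)
qed

lemma card_line_through_le:
  assumes "finite A" "simple_on r A" "no_uniform_minor 2 (2 + q) r A" "e \<in> A" "b \<in> A - {e}"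
  shows "card {a \<in> A - {e}. contract_rank r {e} {a, b} = 1} \<le> q" (is "card ?L \<le> q")
proof -
  have "r {e} = 1" "r {b, e} = 2"
    using assms(2,4,5) by (auto simp: simple_on_def loopless_on_def pairwise_def)
  then have "r (insert a {b, e}) = r {b, e}" if "a \<in> ?L" for a
    using that by (auto simp: contract_rank_def insert_commute)
  then have "r (?L \<union> {b, e}) = 2"
    using rank_Un_eq[of ?L "{b, e}"] \<open>finite A\<close> \<open>r {b, e} = 2\<close> by simp
  moreover have "r (insert e ?L) \<le> r (?L \<union> {b, e})" by (rule rank_mono) auto
  moreover have "insert e ?L \<subseteq> A" using assms(4) by auto
  ultimately have "card (insert e ?L) \<le> Suc q"
    using assms(1-3) by (intro card_line_le)
      (auto intro: simple_on_subset no_uniform_minor_subset)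
  then show ?thesis using \<open>finite A\<close> by simp
qed

text \<open>The points of the contraction by \<open>e\<close> are the lines through \<open>e\<close>, and each of these
  carries at most \<open>q\<close> points other than \<open>e\<close>.\<close>

lemma ex_simple_contraction:
  assumes "finite A" "simple_on r A" "no_uniform_minor 2 (2 + q) r A" "e \<in> A"
  obtains B where "B \<subseteq> A - {e}" "simple_on (contract_rank r {e}) B" "card A \<le> Suc (q * card B)"
proof -
  let ?s = "contract_rank r {e}"
  interpret s: rank_function ?s by (rule rank_function_contract)
  have "loopless_on ?s (A - {e})"
    using assms(2,4)
    by (auto simp: simple_on_def loopless_on_def pairwise_def contract_rank_def insert_commute)
  then obtain B where B: "B \<subseteq> A - {e}" "simple_on ?s B"
    and parallel: "\<And>a. a \<in> A - {e} \<Longrightarrow> \<exists>b \<in> B. ?s {a, b} = 1"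
    using s.ex_simplification[of "A - {e}"] \<open>finite A\<close> by auto
  define L where "L b = {a \<in> A - {e}. ?s {a, b} = 1}" for b
  have "finite B" using B(1) \<open>finite A\<close> finite_subset[of B A] by auto
  have "card (A - {e}) \<le> card (\<Union>b \<in> B. L b)"
    by (rule card_mono) (use \<open>finite B\<close> \<open>finite A\<close> parallel in \<open>auto simp: L_def\<close>)
  also have "\<dots> \<le> (\<Sum>b \<in> B. card (L b))" using \<open>finite B\<close> by (rule card_UN_le)
  also have "\<dots> \<le> (\<Sum>b \<in> B. q)"
    unfolding L_def by (intro sum_mono card_line_through_le) (use assms B(1) in auto)
  finally have "card A \<le> Suc (q * card B)" using \<open>e \<in> A\<close> \<open>finite A\<close> by (simp add: mult.commute)
  then show ?thesis using that B by blast
qed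

end

theorem card_simple_on_le:
  assumes "rank_function r" "finite A" "simple_on r A" "no_uniform_minor 2 (2 + q) r A" "r A \<le> k"
  shows "card A \<le> (\<Sum>i<k. q ^ i)"
  using assms
proof (induction k arbitrary: r A)
  case 0
  interpret rank_function r by fact
  have "a \<notin> A" for a
    using rank_mono[of "{a}" A] 0 by (auto simp: simple_on_def loopless_on_def)
  then have "A = {}" by blast
  then show ?case by simp
next
  case (Suc k)
  interpret rank_function r by fact
  show ?case
  proof (cases "A = {}")
    case False
    then obtain e where "e \<in> A" by blast
    let ?s = "contract_rank r {e}"
    obtain B where B: "B \<subseteq> A - {e}" "simple_on ?s B" "card A \<le> Suc (q * card B)"
      using ex_simple_contraction[OF Suc.prems(2-4) \<open>e \<in> A\<close>] .
    have "card B \<le> (\<Sum>i<k. q ^ i)"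
    proof (rule Suc.IH[OF rank_function_contract])
      show "finite B" using B(1) Suc.prems(2) finite_subset[of B A] by auto
      show "no_uniform_minor 2 (2 + q) ?s B"
        using no_uniform_minor_contract[OF Suc.prems(4) \<open>e \<in> A\<close>] B(1)
        by (rule no_uniform_minor_subset)
      have "r (insert e B) \<le> r A" by (rule rank_mono) (use B(1) \<open>e \<in> A\<close> in auto)
      moreover have "r {e} = 1"
        using Suc.prems(3) \<open>e \<in> A\<close> by (simp add: simple_on_def loopless_on_def)
      ultimately show "?s B \<le> k" using Suc.prems(5) by (simp add: contract_rank_def)
    qed (rule B(2))
    then have "q * card B \<le> q * (\<Sum>i<k. q ^ i)" by (rule mult_le_mono2)
    then have "card A \<le> Suc (q * (\<Sum>i<k. q ^ i))" using B(3) by linarith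
    also have "\<dots> = (\<Sum>i<Suc k. q ^ i)"
      by (simp add: sum.lessThan_Suc_shift sum_distrib_left del: sum.lessThan_Suc)
    finally show ?thesis .
  qed simp
qed


section \<open>Walks and components\<close>

definition adj_rel :: "'v set set \<Rightarrow> 'v set \<Rightarrow> ('v \<times> 'v) set" where
  "adj_rel E S = {(x, y). x \<in> S \<and> y \<in> S \<and> {x, y} \<in> E}"

lemma walk_rel_iff: "(u, v) \<in> walk_rel E S \<longleftrightarrow> u \<in> S \<and> v \<in> S \<and> (u, v) \<in> (adj_rel E S)\<^sup>*"
  by (simp add: walk_rel_def adj_rel_def)

lemma walk_rel_mono:
  assumes "S \<subseteq> T"
  shows "walk_rel E S \<subseteq> walk_rel E T"
proof -
  have "adj_rel E S \<subseteq> adj_rel E T" using assms by (auto simp: adj_rel_def)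
  then have "(adj_rel E S)\<^sup>* \<subseteq> (adj_rel E T)\<^sup>*" by (rule rtrancl_mono)
  then show ?thesis using assms by (auto simp: walk_rel_iff)
qed

lemma walk_rel_trans: "(x, y) \<in> walk_rel E S \<Longrightarrow> (y, z) \<in> walk_rel E S \<Longrightarrow> (x, z) \<in> walk_rel E S"
  by (auto simp: walk_rel_iff)

lemma walk_rel_sym: "(x, y) \<in> walk_rel E S \<Longrightarrow> (y, x) \<in> walk_rel E S"
  using equiv_walk_rel[of S E] by (auto simp: equiv_def dest: symD)

lemma walk_rel_edge: "(x, y) \<in> adj_rel E S \<Longrightarrow> (x, y) \<in> walk_rel E S"
  by (auto simp: walk_rel_iff adj_rel_def)

lemma rtrancl_crossing:
  assumes "(a, b) \<in> R\<^sup>*" "a \<in> S" "b \<notin> S"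
  obtains x y where "(x, y) \<in> R" "x \<in> S" "y \<notin> S"
  using assms by (induction rule: rtrancl_induct) auto

lemma component_closed:
  assumes "C \<in> S // walk_rel E S" "x \<in> C" "(x, y) \<in> adj_rel E S"
  shows "y \<in> C"
  using in_quotient_imp_closed[OF equiv_walk_rel assms(1,2)] walk_rel_edge[OF assms(3)] by blast

lemma component_connected:
  assumes C: "C \<in> S // walk_rel E S"
  shows "C \<times> C \<subseteq> walk_rel E C"
proof (intro subrelI)
  fix x y assume "(x, y) \<in> C \<times> C"
  then have "x \<in> C" "(x, y) \<in> (adj_rel E S)\<^sup>*"
    using in_quotient_imp_in_rel[OF equiv_walk_rel C, of x y] by (auto simp: walk_rel_iff)
  from this(2) show "(x, y) \<in> walk_rel E C"
  proof (induction rule: rtrancl_induct)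
    case base
    show ?case using \<open>x \<in> C\<close> by (simp add: walk_rel_iff)
  next
    case (step y z)
    then have "y \<in> C" "z \<in> C" using component_closed[OF C] by (auto simp: walk_rel_iff)
    then have "(y, z) \<in> walk_rel E C"
      using step.hyps by (intro walk_rel_edge) (simp add: adj_rel_def)
    with step.IH show ?case by (rule walk_rel_trans)
  qed
qed

lemma componentI:
  assumes "x \<in> C" "C \<subseteq> S" and connected: "C \<times> C \<subseteq> walk_rel E C"
    and closed: "\<And>y z. (y, z) \<in> adj_rel E S \<Longrightarrow> y \<in> C \<Longrightarrow> z \<in> C"
  shows "C \<in> S // walk_rel E S"
proof -
  have "walk_rel E S `` {x} = C"
  proof
    show "C \<subseteq> walk_rel E S `` {x}"
      using \<open>x \<in> C\<close> connected walk_rel_mono[OF \<open>C \<subseteq> S\<close>, of E] by blast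
    show "walk_rel E S `` {x} \<subseteq> C"
    proof
      fix y assume "y \<in> walk_rel E S `` {x}"
      then have "(x, y) \<in> (adj_rel E S)\<^sup>*" by (simp add: walk_rel_iff)
      then show "y \<in> C" by (rule rtrancl_induct) (use \<open>x \<in> C\<close> closed in auto)
    qed
  qed
  moreover have "x \<in> S" using assms(1,2) by blast
  ultimately show ?thesis using quotientI[of x S "walk_rel E S"] by simp
qed

lemma partition_on_components_minus: "partition_on (V - {v}) (components_minus V E v)"
  unfolding components_minus_def using equiv_walk_rel by (rule partition_on_quotient)

lemma components_minus_disjoint:
  "C \<in> components_minus V E v \<Longrightarrow> D \<in> components_minus V E v \<Longrightarrow> C \<noteq> D \<Longrightarrow> C \<inter> D = {}"
  using partition_onD2[OF partition_on_components_minus] by (rule disjointD)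

lemma components_minus_subset: "C \<in> components_minus V E v \<Longrightarrow> C \<subseteq> V - {v}"
  using partition_onD1[OF partition_on_components_minus[of V v E]] by blast

lemma finite_components_minus: "finite V \<Longrightarrow> finite (components_minus V E v)"
  unfolding components_minus_def by (rule finite_quotient) (auto simp: walk_rel_def)


section \<open>Trees\<close>

lemma is_cycle_ConsI:
  assumes path: "rtrancl_path (\<lambda>x y. {x, y} \<in> E) u xs w" and "xs \<noteq> []" "distinct (v # u # xs)"
    and "{u, v} \<in> E" "{w, v} \<in> E"
  shows "is_cycle E (v # u # xs)"
  unfolding is_cycle_def
proof (intro conjI allI impI)
  let ?c = "v # u # xs"
  show "length ?c \<ge> 3" using \<open>xs \<noteq> []\<close> by (cases xs) auto
  fix i assume i: "i < length ?c"
  consider (first) "i = 0" | (inner) j where "i = Suc j" "j < length xs"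
    | (last) "i = Suc (length xs)"
    using i by (cases i) (auto simp: less_Suc_eq)
  then show "{?c ! i, ?c ! (Suc i mod length ?c)} \<in> E"
  proof cases
    case first
    then show ?thesis using \<open>{u, v} \<in> E\<close> by (simp add: insert_commute)
  next
    case inner
    then show ?thesis using rtrancl_path_nth[OF path] by simp
  next
    case last
    then have "?c ! i = w"
      using rtrancl_path_last[OF path] \<open>xs \<noteq> []\<close> by (simp add: last_conv_nth nth_Cons')
    then show ?thesis using last \<open>{w, v} \<in> E\<close> by simp
  qed
qed (use assms in simp)

lemma component_attached:
  assumes tree: "is_tree V E" and "v \<in> V" and C: "C \<in> components_minus V E v"
  obtains u where "u \<in> C" "{u, v} \<in> E"
proof -
  note C_subset = components_minus_subset[OF C]
  have "C \<noteq> {}" using C partition_onD3[OF partition_on_components_minus[of V v E]] by auto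
  then obtain w where "w \<in> C" by blast
  then have "(w, v) \<in> (adj_rel E V)\<^sup>*"
    using tree \<open>v \<in> V\<close> C_subset by (auto simp: is_tree_def walk_rel_iff)
  then obtain x y where xy: "(x, y) \<in> adj_rel E V" "x \<in> C" "y \<notin> C"
    using rtrancl_crossing[of w v _ C] \<open>w \<in> C\<close> C_subset by blast
  have "y = v"
  proof (rule ccontr)
    assume "y \<noteq> v"
    then have "(x, y) \<in> adj_rel E (V - {v})" using xy C_subset by (auto simp: adj_rel_def)
    then show False using component_closed[of C] C xy unfolding components_minus_def by blast
  qed
  then show ?thesis using xy that by (auto simp: adj_rel_def)
qed

lemma component_attached_unique:
  assumes tree: "is_tree V E" and C: "C \<in> components_minus V E v"
    and u: "u \<in> C" "{u, v} \<in> E" and w: "w \<in> C" "{w, v} \<in> E"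
  shows "u = w"
proof (rule ccontr)
  assume "u \<noteq> w"
  have "(u, w) \<in> walk_rel E C"
    using component_connected C u(1) w(1) unfolding components_minus_def by blast
  then have "(\<lambda>x y. (x, y) \<in> adj_rel E C)\<^sup>*\<^sup>* u w"
    by (simp add: walk_rel_iff rtranclp_rtrancl_eq)
  then obtain xs where path: "rtrancl_path (\<lambda>x y. (x, y) \<in> adj_rel E C) u xs w"
    and "distinct (u # xs)"
    by (auto simp: rtranclp_eq_rtrancl_path elim: rtrancl_path_distinct)
  have "xs \<noteq> []" using path \<open>u \<noteq> w\<close> by (auto elim: rtrancl_path.cases)
  have "set xs \<subseteq> C" using rtrancl_path_Range[OF path] by (auto simp: adj_rel_def)
  then have "v \<notin> set (u # xs)" using components_minus_subset[OF C] \<open>u \<in> C\<close> by auto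
  moreover have "rtrancl_path (\<lambda>x y. {x, y} \<in> E) u xs w"
    by (rule rtrancl_path_mono[OF path]) (simp add: adj_rel_def)
  ultimately have "is_cycle E (v # u # xs)"
    using \<open>xs \<noteq> []\<close> \<open>distinct (u # xs)\<close> assms by (intro is_cycle_ConsI[of E u xs w]) auto
  then show False using tree by (auto simp: is_tree_def)
qed

lemma walk_outside_component:
  assumes tree: "is_tree V E" and v: "v \<in> V" and C: "C \<in> components_minus V E v"
    and w: "w \<in> V - C"
  shows "(w, v) \<in> walk_rel E (V - C)"
proof (cases "w = v")
  case True
  then show ?thesis using w by (simp add: walk_rel_iff)
next
  case False
  then obtain D where D: "D \<in> components_minus V E v" and "w \<in> D"
    using partition_onD1[OF partition_on_components_minus[of V v E]] w by blast
  then have "D \<inter> C = {}" using components_minus_disjoint[OF D C] w by blast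
  then have "D \<subseteq> V - C" "v \<in> V - C"
    using components_minus_subset[OF D] components_minus_subset[OF C] v by auto
  obtain u where u: "u \<in> D" "{u, v} \<in> E" using component_attached[OF tree v D] .
  have "(w, u) \<in> walk_rel E (V - C)"
    using component_connected[of D "V - {v}" E] D \<open>w \<in> D\<close> u(1) walk_rel_mono[OF \<open>D \<subseteq> V - C\<close>]
    unfolding components_minus_def by blast
  moreover have "(u, v) \<in> walk_rel E (V - C)"
    by (rule walk_rel_edge) (use u \<open>D \<subseteq> V - C\<close> \<open>v \<in> V - C\<close> in \<open>auto simp: adj_rel_def\<close>)
  ultimately show ?thesis by (rule walk_rel_trans)
qed

lemma complement_component:
  assumes tree: "is_tree V E" and v: "v \<in> V" and C: "C \<in> components_minus V E v"
  obtains u where "u \<in> C" "V - C \<in> components_minus V E u"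
proof -
  note C_subset = components_minus_subset[OF C]
  obtain u where u: "u \<in> C" "{u, v} \<in> E" using component_attached[OF tree v C] .
  have "V - C \<in> (V - {u}) // walk_rel E (V - {u})"
  proof (rule componentI)
    show "v \<in> V - C" using v C_subset by blast
    show "V - C \<subseteq> V - {u}" using u(1) by blast
    show "(V - C) \<times> (V - C) \<subseteq> walk_rel E (V - C)"
    proof (intro subrelI)
      fix x y assume "(x, y) \<in> (V - C) \<times> (V - C)"
      then have "(x, v) \<in> walk_rel E (V - C)" "(y, v) \<in> walk_rel E (V - C)"
        using walk_outside_component[OF tree v C] by blast+
      then show "(x, y) \<in> walk_rel E (V - C)" using walk_rel_trans walk_rel_sym by fast
    qed
    fix x y assume xy: "(x, y) \<in> adj_rel E (V - {u})" "x \<in> V - C"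
    show "y \<in> V - C"
    proof (rule ccontr)
      assume "y \<notin> V - C"
      then have "y \<in> C" "y \<noteq> u" "{y, x} \<in> E" using xy(1) by (auto simp: adj_rel_def insert_commute)
      moreover from this have "(y, x) \<notin> adj_rel E (V - {v})"
        using component_closed[of C "V - {v}" E y x] C xy(2) unfolding components_minus_def by blast
      ultimately have "x = v" using xy(2) C_subset by (auto simp: adj_rel_def)
      then show False
        using component_attached_unique[OF tree C u, of y] \<open>y \<in> C\<close> \<open>y \<noteq> u\<close> \<open>{y, x} \<in> E\<close> by simp
    qed
  qed
  then show ?thesis using that u(1) by (simp add: components_minus_def)
qed

lemma ex_minimal_component:
  assumes tree: "is_tree V E" and "v \<in> V" "C \<in> components_minus V E v" "P C"
  obtains u D where "u \<in> V" "D \<subseteq> V" "P D" "V - D \<in> components_minus V E u"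
    "\<And>C. C \<in> components_minus V E u \<Longrightarrow> C \<noteq> V - D \<Longrightarrow> \<not> P C"
proof -
  define Q where "Q D \<longleftrightarrow> P D \<and> (\<exists>v \<in> V. D \<in> components_minus V E v)" for D
  have "Q C" using assms by (auto simp: Q_def)
  then obtain D where "Q D" and minimal: "\<And>C. Q C \<Longrightarrow> card D \<le> card C"
    using ex_has_least_nat[of Q C card] by blast
  then obtain v where v: "v \<in> V" "D \<in> components_minus V E v" by (auto simp: Q_def)
  obtain u where u: "u \<in> D" "V - D \<in> components_minus V E u"
    using complement_component[OF tree v] .
  have "D \<subseteq> V" using components_minus_subset[OF v(2)] by blast
  then have "u \<in> V" "finite D" using u tree finite_subset by (auto simp: is_tree_def)
  have "\<not> P C" if C: "C \<in> components_minus V E u" "C \<noteq> V - D" for C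
  proof
    assume "P C"
    have "C \<subset> D"
      using components_minus_subset[OF C(1)] components_minus_disjoint[OF C(1) u(2) C(2)] u(1)
      by blast
    then have "card C < card D" using \<open>finite D\<close> by (intro psubset_card_mono)
    moreover have "Q C" using \<open>P C\<close> C(1) \<open>u \<in> V\<close> by (auto simp: Q_def)
    ultimately show False using minimal by fastforce
  qed
  then show ?thesis using that \<open>u \<in> V\<close> \<open>D \<subseteq> V\<close> \<open>Q D\<close> u(2) by (auto simp: Q_def)
qed


section \<open>Tree-width\<close>

text \<open>The subtraction is not truncated for a monotone \<open>r\<close>.\<close>

definition defect :: "('a set \<Rightarrow> nat) \<Rightarrow> 'a set \<Rightarrow> 'a set \<Rightarrow> nat" where
  "defect r A B = r A - r (A - B)"

definition tree_width_at_most :: "nat \<Rightarrow> ('a set \<Rightarrow> nat) \<Rightarrow> 'a set \<Rightarrow> bool" where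
  "tree_width_at_most k r A \<longleftrightarrow> (\<exists>(V :: nat set) E \<tau>. is_tree V E \<and> \<tau> ` A \<subseteq> V \<and>
     (\<forall>v \<in> V. r A \<le> k + (\<Sum>C \<in> components_minus V E v. defect r A (\<tau> -` C))))"

lemma sum_if_mem_components_minus_le:
  assumes "finite V"
  shows "(\<Sum>C \<in> components_minus V E v. if x \<in> C then d else 0) \<le> (d :: nat)"
proof -
  let ?K = "{C \<in> components_minus V E v. x \<in> C}"
  have "finite (components_minus V E v)" using assms by (rule finite_components_minus)
  then have "(\<Sum>C \<in> components_minus V E v. if x \<in> C then d else 0) = card ?K * d"
    by (simp flip: sum.inter_filter)
  moreover have "card ?K \<le> Suc 0"
  proof -
    have "finite ?K" using \<open>finite (components_minus V E v)\<close> by simp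
    moreover have "C = D" if "C \<in> ?K" "D \<in> ?K" for C D
      using that components_minus_disjoint[of C V E v D] by blast
    ultimately show ?thesis by (simp add: card_le_Suc0_iff_eq)
  qed
  ultimately show ?thesis using mult_le_mono1[of "card ?K" "Suc 0" d] by simp
qed

text \<open>Rank defects drop only for the one set \<open>B\<close> that contains the removed element \<open>e\<close>, and there
  by no more than the total rank does.\<close>

lemma tree_width_at_most_remove:
  assumes "tree_width_at_most k r A" and total: "s (A - {e}) + d = r A"
    and defect: "\<And>B. defect r A B \<le> defect s (A - {e}) B + (if e \<in> B then d else 0)"
  shows "tree_width_at_most k s (A - {e})"
proof -
  obtain V :: "nat set" and E \<tau> where tree: "is_tree V E" "\<tau> ` A \<subseteq> V"
    and width: "\<And>v. v \<in> V \<Longrightarrow> r A \<le> k + (\<Sum>C \<in> components_minus V E v. defect r A (\<tau> -` C))"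
    using assms(1) unfolding tree_width_at_most_def by (elim exE conjE) (rule that, blast+)
  have "s (A - {e}) \<le> k + (\<Sum>C \<in> components_minus V E v. defect s (A - {e}) (\<tau> -` C))"
    if "v \<in> V" for v
  proof -
    let ?K = "components_minus V E v"
    have "(\<Sum>C \<in> ?K. defect r A (\<tau> -` C))
        \<le> (\<Sum>C \<in> ?K. defect s (A - {e}) (\<tau> -` C) + (if \<tau> e \<in> C then d else 0))"
      using defect[of "\<tau> -` C" for C] by (intro sum_mono) simp
    also have "\<dots> \<le> (\<Sum>C \<in> ?K. defect s (A - {e}) (\<tau> -` C)) + d"
      unfolding sum.distrib using tree(1)
      by (intro add_left_mono sum_if_mem_components_minus_le) (simp add: is_tree_def)
    finally show ?thesis using width[OF \<open>v \<in> V\<close>] total by linarith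
  qed
  moreover have "\<tau> ` (A - {e}) \<subseteq> V" using tree(2) by blast
  ultimately show ?thesis using tree(1) unfolding tree_width_at_most_def by blast
qed

context rank_function
begin

lemma tree_width_at_most_delete:
  assumes "tree_width_at_most k r A" "e \<in> A"
  shows "tree_width_at_most k r (A - {e})"
proof (rule tree_width_at_most_remove[OF assms(1)])
  show "r (A - {e}) + (r A - r (A - {e})) = r A" by (simp add: rank_mono)
  fix B
  show "defect r A B \<le> defect r (A - {e}) B + (if e \<in> B then r A - r (A - {e}) else 0)"
  proof (cases "e \<in> B")
    case True
    then have "A - {e} - B = A - B" by auto
    then show ?thesis using True by (simp add: defect_def)
  next
    case False
    then have "(A - {e}) \<union> (A - B) = A" "(A - {e}) \<inter> (A - B) = A - {e} - B" using assms(2) by auto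
    then have "r A + r (A - {e} - B) \<le> r (A - {e}) + r (A - B)"
      using rank_submodular[of "A - {e}" "A - B"] by simp
    then show ?thesis using False by (simp add: defect_def)
  qed
qed

lemma tree_width_at_most_contract:
  assumes "tree_width_at_most k r A" "e \<in> A"
  shows "tree_width_at_most k (contract_rank r {e}) (A - {e})"
proof (rule tree_width_at_most_remove[OF assms(1)])
  have e: "insert e A = A" "r {e} \<le> r A" using assms(2) by (auto intro: rank_mono)
  then show "contract_rank r {e} (A - {e}) + r {e} = r A" by (simp add: contract_rank_def)
  fix B
  have "r {e} \<le> r (insert e (A - {e} - B))" by (rule rank_mono) simp
  moreover have "insert e (A - {e} - B) = insert e (A - B)" by auto
  ultimately have "defect (contract_rank r {e}) (A - {e}) B = r A - r (insert e (A - B))"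
    using e by (simp add: defect_def contract_rank_def)
  moreover have "r (insert e (A - B)) \<le> r (A - B) + (if e \<in> B then r {e} else 0)"
    using rank_submodular[of "{e}" "A - B"] assms(2) by (simp add: insert_absorb)
  ultimately show "defect r A B
      \<le> defect (contract_rank r {e}) (A - {e}) B + (if e \<in> B then r {e} else 0)"
    unfolding defect_def by linarith
qed

text \<open>At the end \<open>u\<close> in \<open>D\<close> of the edge leaving a smallest component \<open>D\<close> of positive defect,
  only \<open>V - D\<close> contributes to the node width, which is therefore the rank of the elements
  of \<open>D\<close>.\<close>

lemma ex_low_rank_nonspanning_complement:
  assumes "tree_width_at_most k r A" "0 < r A"
  obtains B where "B \<subseteq> A" "r (A - B) < r A" "r B \<le> k"
proof -
  obtain V :: "nat set" and E \<tau> where tree: "is_tree V E" "\<tau> ` A \<subseteq> V"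
    and width: "\<And>v. v \<in> V \<Longrightarrow> r A \<le> k + (\<Sum>C \<in> components_minus V E v. defect r A (\<tau> -` C))"
    using assms(1) unfolding tree_width_at_most_def by (elim exE conjE) (rule that, blast+)
  show ?thesis
  proof (cases "\<exists>v \<in> V. \<exists>C \<in> components_minus V E v. 0 < defect r A (\<tau> -` C)")
    case False
    moreover obtain v where "v \<in> V" using tree(1) by (auto simp: is_tree_def)
    ultimately have "r A \<le> k" using width[of v] by simp
    then show ?thesis using that[of A] \<open>0 < r A\<close> rank_empty by simp
  next
    case True
    then obtain u D where "u \<in> V" "D \<subseteq> V" and positive: "0 < defect r A (\<tau> -` D)"
      and comp: "V - D \<in> components_minus V E u"
      and others: "\<And>C. C \<in> components_minus V E u \<Longrightarrow> C \<noteq> V - D \<Longrightarrow> \<not> 0 < defect r A (\<tau> -` C)"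
      using ex_minimal_component[OF tree(1), where P = "\<lambda>C. 0 < defect r A (\<tau> -` C)"] by metis
    let ?B = "A \<inter> \<tau> -` D"
    have "finite (components_minus V E u)"
      using tree(1) by (auto simp: is_tree_def intro: finite_components_minus)
    then have "(\<Sum>C \<in> components_minus V E u. defect r A (\<tau> -` C)) = defect r A (\<tau> -` (V - D))"
      using others by (simp add: sum.remove[OF _ comp])
    moreover have "A - \<tau> -` (V - D) = ?B" using tree(2) by auto
    ultimately have "r A \<le> k + (r A - r ?B)" using width[OF \<open>u \<in> V\<close>] by (simp add: defect_def)
    moreover have "r ?B \<le> r A" by (rule rank_mono) simp
    ultimately have "r ?B \<le> k" by simp
    moreover have "A - ?B = A - \<tau> -` D" by auto
    ultimately show ?thesis using that[of ?B] positive by (simp add: defect_def)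
  qed
qed

lemma ex_small_cocircuit:
  assumes "finite A" "A \<noteq> {}" "simple_on r A" "no_uniform_minor 2 (2 + q) r A"
    and "tree_width_at_most k r A"
  obtains H where "hyperplane r A H" "card (A - H) \<le> (\<Sum>i<k. q ^ i)"
proof -
  obtain a where "a \<in> A" using \<open>A \<noteq> {}\<close> by blast
  then have "0 < r A"
    using rank_mono[of "{a}" A] assms(3) by (auto simp: simple_on_def loopless_on_def)
  then obtain B where B: "B \<subseteq> A" "r (A - B) < r A" "r B \<le> k"
    using ex_low_rank_nonspanning_complement assms(5) by blast
  then obtain H where H: "hyperplane r A H" "A - B \<subseteq> H"
    using ex_hyperplane_above[of A "A - B"] \<open>finite A\<close> by blast
  have "finite B" using B(1) \<open>finite A\<close> by (rule finite_subset)
  then have "card (A - H) \<le> card B" using H(2) by (intro card_mono) auto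
  also have "\<dots> \<le> (\<Sum>i<k. q ^ i)"
    using B simple_on_subset[OF assms(3)] no_uniform_minor_subset[OF assms(4)]
    by (intro card_simple_on_le[OF rank_function_axioms \<open>finite B\<close>])
  finally show ?thesis using that H(1) by blast
qed

end

lemma minor_closed_class_tree_width_at_most:
  "minor_closed_class (\<lambda>r A. rank_function r \<and> finite A \<and> tree_width_at_most k r A \<and>
     no_uniform_minor n m r A)" (is "minor_closed_class ?K")
proof (rule minor_closed_class.intro)
  show "rank_function r" "finite A" if "?K r A" for r A using that by blast+
  show "?K r (A - {e})" "?K (contract_rank r {e}) (A - {e})" if "?K r A" "e \<in> A" for r A e
  proof -
    interpret rank_function r using that by blast
    show "?K r (A - {e})"
      using that tree_width_at_most_delete no_uniform_minor_subset by blast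
    show "?K (contract_rank r {e}) (A - {e})"
      using that tree_width_at_most_contract no_uniform_minor_contract rank_function_contract
      by blast
  qed
qed

theorem whitney_sum_pos_of_tree_width:
  fixes r :: "'a set \<Rightarrow> nat" and x :: "'b::linordered_idom"
  assumes "rank_function r" "finite A" "loopless_on r A" "tree_width_at_most k r A"
    and "no_uniform_minor 2 (2 + q) r A" and x: "of_nat (\<Sum>i<k. q ^ i) < x"
  shows "0 < whitney_sum r A x"
proof (rule minor_closed_class.whitney_sum_pos
    [OF minor_closed_class_tree_width_at_most[of k 2 "2 + q"]])
  fix r :: "'a set \<Rightarrow> nat" and A
  assume "rank_function r \<and> finite A \<and> tree_width_at_most k r A \<and> no_uniform_minor 2 (2 + q) r A"
    and "simple_on r A" "A \<noteq> {}"
  then obtain H where "hyperplane r A H" "card (A - H) \<le> (\<Sum>i<k. q ^ i)"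
    using rank_function.ex_small_cocircuit[of r A q k] by blast
  moreover from this have "of_nat (card (A - H)) < x"
    using x of_nat_mono order_le_less_trans by blast
  ultimately show "\<exists>H. hyperplane r A H \<and> of_nat (card (A - H)) < x" by blast
qed (use assms in blast)+


section \<open>The rank function of a matroid\<close>

context matroid
begin

lemma card_le_rk: "I \<in> indeps M \<Longrightarrow> I \<subseteq> X \<Longrightarrow> card I \<le> rk M X"
  unfolding rk_def using finite_indeps by (intro Max_ge) auto

lemma finite_indep: "I \<in> indeps M \<Longrightarrow> finite I"
  using indeps_subset finite_ground finite_subset by blast

lemma ex_basis:
  obtains I where "I \<in> indeps M" "I \<subseteq> X" "card I = rk M X"
proof -
  have "rk M X \<in> card ` {I \<in> indeps M. I \<subseteq> X}"
    unfolding rk_def using finite_indeps empty_indep by (intro Max_in) auto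
  then show ?thesis using that by auto
qed

lemma ex_basis_extending:
  assumes "I \<in> indeps M" "I \<subseteq> X"
  obtains J where "J \<in> indeps M" "I \<subseteq> J" "J \<subseteq> X" "card J = rk M X"
proof -
  let ?S = "{J \<in> indeps M. J \<subseteq> X}"
  have "finite ?S" using finite_indeps by simp
  then obtain J where J: "J \<in> ?S" "I \<subseteq> J" and maximal: "\<forall>J' \<in> ?S. J \<subseteq> J' \<longrightarrow> J = J'"
    using finite_has_maximal2[of ?S I] assms by blast
  obtain K where K: "K \<in> indeps M" "K \<subseteq> X" "card K = rk M X" using ex_basis .
  have "card J \<le> rk M X" using J card_le_rk by blast
  moreover have "\<not> card J < card K"
  proof
    assume "card J < card K"
    then obtain e where "e \<in> K - J" "insert e J \<in> indeps M" using augment J K by blast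
    then have "J = insert e J" using maximal J K(2) by blast
    then show False using \<open>e \<in> K - J\<close> by blast
  qed
  ultimately show ?thesis using that J K(3) by auto
qed

lemma rk_indep:
  assumes "I \<in> indeps M"
  shows "rk M I = card I"
proof (rule antisym)
  obtain J where "J \<subseteq> I" "card J = rk M I" using ex_basis .
  then show "rk M I \<le> card I" using card_mono[OF finite_indep[OF assms]] by metis
  show "card I \<le> rk M I" using assms card_le_rk by blast
qed

lemma rank_function_rk: "rank_function (rk M)"
proof
  show "rk M {} = 0" using rk_indep[OF empty_indep] by simp
  show "rk M {e} \<le> 1" for e
  proof -
    obtain I where "I \<subseteq> {e}" "card I = rk M {e}" using ex_basis .
    then show ?thesis using card_mono[of "{e}" I] by simp
  qed
  show "rk M X \<le> rk M Y" if "X \<subseteq> Y" for X Y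
  proof -
    obtain I where "I \<in> indeps M" "I \<subseteq> X" "card I = rk M X" using ex_basis .
    then show ?thesis using card_le_rk[of I Y] that by auto
  qed
  show "rk M (X \<union> Y) + rk M (X \<inter> Y) \<le> rk M X + rk M Y" for X Y
  proof -
    obtain I where I: "I \<in> indeps M" "I \<subseteq> X \<inter> Y" "card I = rk M (X \<inter> Y)" using ex_basis .
    then obtain J where J: "J \<in> indeps M" "I \<subseteq> J" "J \<subseteq> X \<union> Y" "card J = rk M (X \<union> Y)"
      using ex_basis_extending[of I "X \<union> Y"] by blast
    have "finite J" using J(1) by (rule finite_indep)
    have "card (J \<inter> X) \<le> rk M X" "card (J \<inter> Y) \<le> rk M Y"
      using J(1) by (auto intro!: card_le_rk intro: indep_mono)
    moreover have "card (J \<inter> X) + card (J \<inter> Y) = card (J \<inter> X \<union> J \<inter> Y) + card (J \<inter> X \<inter> (J \<inter> Y))"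
      using \<open>finite J\<close> by (intro card_Un_Int) auto
    moreover have "J \<inter> X \<union> J \<inter> Y = J" using J(3) by auto
    moreover have "card I \<le> card (J \<inter> X \<inter> (J \<inter> Y))"
      by (rule card_mono) (use \<open>finite J\<close> I(2) J(2) in auto)
    ultimately show ?thesis using I(3) J(4) by simp
  qed
qed

lemma loopless_on_rk: "loopless M \<Longrightarrow> loopless_on (rk M) (ground M)"
  using rk_indep by (auto simp: loopless_on_def loopless_def is_loop_def)

end

sublocale matroid \<subseteq> rank_function "rk M"
  by (rule rank_function_rk)

lemma matroid_iso_uniform_matroidI:
  assumes "finite (ground N)" "card (ground N) = m"
    and indep: "\<And>I. I \<subseteq> ground N \<Longrightarrow> I \<in> indeps N \<longleftrightarrow> card I \<le> n"
  shows "matroid_iso N (uniform_matroid n m)"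
proof -
  obtain f where f: "bij_betw f (ground N) {..<m}"
    using finite_same_card_bij[of "ground N" "{..<m}"] assms(1,2) by auto
  have "I \<in> indeps N \<longleftrightarrow> f ` I \<in> indeps (uniform_matroid n m)" if "I \<subseteq> ground N" for I
  proof -
    have "card (f ` I) = card I" "f ` I \<subseteq> {..<m}"
      using f that card_image[of f I] inj_on_subset[of f "ground N" I] by (auto simp: bij_betw_def)
    then show ?thesis using indep[OF that] by (simp add: uniform_matroid_def)
  qed
  then show ?thesis using f unfolding matroid_iso_def by (auto simp: uniform_matroid_def)
qed

context matroid
begin

lemma no_uniform_minor_rk:
  assumes "\<not> (\<exists>N. is_minor N M \<and> matroid_iso N (uniform_matroid n m))"
  shows "no_uniform_minor n m (rk M) (ground M)"
  unfolding no_uniform_minor_def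
proof (intro allI impI notI, elim conjE)
  fix C S
  assume C: "C \<subseteq> ground M" and S: "S \<subseteq> ground M - C" "card S = m"
    and uniform: "uniform_on (contract_rank (rk M) C) n S"
  let ?N = "delete (contract M C) (ground M - C - S)"
  have ground: "ground ?N = S" using S(1) by (auto simp: delete_def contract_def)
  have "matroid_iso ?N (uniform_matroid n m)"
  proof (rule matroid_iso_uniform_matroidI)
    fix I assume "I \<subseteq> ground ?N"
    then have "I \<subseteq> S" by (simp only: ground)
    then have "I \<in> indeps ?N \<longleftrightarrow> rk M (I \<union> C) = card I + rk M C"
      using S(1) by (auto simp: delete_def contract_def)
    also have "\<dots> \<longleftrightarrow> contract_rank (rk M) C I = card I"
      using rank_mono[of C "I \<union> C"] by (auto simp: contract_rank_def)
    also have "\<dots> \<longleftrightarrow> card I \<le> n" using uniform \<open>I \<subseteq> S\<close> by (auto simp: uniform_on_def)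
    finally show "I \<in> indeps ?N \<longleftrightarrow> card I \<le> n" .
  qed (use S finite_ground finite_subset in \<open>auto simp: ground\<close>)
  moreover have "is_minor ?N M"
    unfolding is_minor_def by (intro exI[of _ C] exI[of _ "ground M - C - S"]) (use C in auto)
  ultimately show False using assms by blast
qed

lemma node_width_le_iff:
  "node_width M V E \<tau> v \<le> int k \<longleftrightarrow> rk M (ground M) \<le>
     k + (\<Sum>C \<in> components_minus V E v. defect (rk M) (ground M) (\<tau> -` C))"
proof -
  have "rank_defect M {e \<in> ground M. \<tau> e \<in> C} = int (defect (rk M) (ground M) (\<tau> -` C))" for C
  proof -
    have "ground M - {e \<in> ground M. \<tau> e \<in> C} = ground M - \<tau> -` C" by auto
    then show ?thesis by (simp add: rank_defect_def defect_def of_nat_diff rank_mono)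
  qed
  then show ?thesis by (simp add: node_width_def flip: of_nat_sum) linarith
qed

lemma tree_width_at_most_rk:
  assumes "tree_width M \<le> int k"
  shows "tree_width_at_most k (rk M) (ground M)"
proof -
  obtain V :: "nat set" and E \<tau> where decomposition: "tree_decomposition M V E \<tau>"
    and width: "tree_width M = decomposition_width M V E \<tau>"
    using tree_width_attained by (auto simp: tree_widths_def)
  then have tree: "is_tree V E" "\<tau> ` ground M \<subseteq> V" by (auto simp: tree_decomposition_def)
  have "node_width M V E \<tau> v \<le> int k" if "v \<in> V" for v
  proof -
    have "node_width M V E \<tau> v \<le> decomposition_width M V E \<tau>"
      unfolding decomposition_width_def
      using tree(1) that by (intro Max_ge) (auto simp: is_tree_def)
    then show ?thesis using width assms by simp
  qed
  then show ?thesis using tree unfolding tree_width_at_most_def node_width_le_iff by blast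
qed

end


section \<open>Whitney's formula for the characteristic polynomial\<close>

lemma sum_sign_Pow:
  assumes "finite F"
  shows "(\<Sum>X \<in> Pow F. (-1) ^ card X) = (if F = {} then 1 else 0 :: 'b::comm_ring_1)"
  using prod_diff_conv_sum[OF assms, of "\<lambda>_. 1 :: 'b" "\<lambda>_. 1"] assms by (simp add: power_0_left)

lemma moebius_eqI:
  fixes g :: "'b::order \<Rightarrow> int"
  assumes "finite P" "x \<in> P"
    and sum_g: "\<And>z. z \<in> P \<Longrightarrow> x \<le> z \<Longrightarrow>
      (\<Sum>y \<in> {y \<in> P. x \<le> y \<and> y \<le> z}. g y) = (if z = x then 1 else 0)"
    and "z \<in> P" "x \<le> z"
  shows "moebius P x z = g z"
  using assms(4,5)
proof (induction "card {y \<in> P. y < z}" arbitrary: z rule: less_induct)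
  case less
  let ?Y = "{y \<in> P. x \<le> y \<and> y < z}"
  have "{y \<in> P. x \<le> y \<and> y \<le> z} = insert z ?Y" using less.prems by auto
  then have rec: "g z + (\<Sum>y \<in> ?Y. g y) = (if z = x then 1 else 0)"
    using sum_g[OF less.prems] \<open>finite P\<close> by simp
  show ?case
  proof (cases "z = x")
    case True
    then have empty: "?Y = {}" by auto
    show ?thesis using rec True unfolding empty by (simp add: moebius.simps)
  next
    case False
    have "moebius P x y = g y" if "y \<in> ?Y" for y
    proof (rule less.hyps)
      show "card {w \<in> P. w < y} < card {w \<in> P. w < z}"
        by (rule psubset_card_mono) (use \<open>finite P\<close> that in \<open>auto intro: less_trans\<close>)
    qed (use that in auto)
    then have "moebius P x z = - (\<Sum>y \<in> ?Y. g y)"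
      using False \<open>finite P\<close> less.prems by (subst moebius.simps) (auto intro!: sum.cong)
    then show ?thesis using rec False by simp
  qed
qed

context matroid
begin

definition flat_closure :: "'a set \<Rightarrow> 'a set" where
  "flat_closure X = {e \<in> ground M. rk M (insert e X) = rk M X}"

lemma subset_flat_closure: "X \<subseteq> ground M \<Longrightarrow> X \<subseteq> flat_closure X"
  by (auto simp: flat_closure_def insert_absorb)

lemma rk_flat_closure:
  assumes "X \<subseteq> ground M"
  shows "rk M (flat_closure X) = rk M X"
proof -
  have "rk M (flat_closure X \<union> X) = rk M X"
    by (rule rank_Un_eq) (auto simp: flat_closure_def finite_ground)
  then show ?thesis using subset_flat_closure[OF assms] by (simp add: Un_absorb2)
qed

lemma flat_closure_in_flats:
  assumes "X \<subseteq> ground M"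
  shows "flat_closure X \<in> flats M"
  unfolding flats_def
proof (intro CollectI conjI ballI)
  show "flat_closure X \<subseteq> ground M" by (auto simp: flat_closure_def)
  fix e assume "e \<in> ground M - flat_closure X"
  then have "rk M X < rk M (insert e X)"
    using rank_insert_ge[of X e] by (auto simp: flat_closure_def)
  also have "\<dots> \<le> rk M (insert e (flat_closure X))"
    by (rule rank_mono) (use subset_flat_closure[OF assms] in auto)
  finally show "rk M (flat_closure X) < rk M (insert e (flat_closure X))"
    by (simp only: rk_flat_closure[OF assms])
qed

lemma flat_closure_subset_flat_iff:
  assumes "X \<subseteq> ground M" "F \<in> flats M"
  shows "flat_closure X \<subseteq> F \<longleftrightarrow> X \<subseteq> F"
proof
  show "X \<subseteq> F" if "flat_closure X \<subseteq> F" using that subset_flat_closure[OF assms(1)] by blast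
  show "flat_closure X \<subseteq> F" if "X \<subseteq> F"
  proof
    fix e assume e: "e \<in> flat_closure X"
    then have "rk M (insert e F) = rk M F"
      using rank_insert_eq_mono[of e X F] that by (simp add: flat_closure_def)
    then show "e \<in> F" using e assms(2) by (force simp: flat_closure_def flats_def)
  qed
qed

lemma finite_flats: "finite (flats M)"
  by (rule finite_subset[of _ "Pow (ground M)"]) (auto simp: flats_def finite_ground)

lemma empty_flat: "loopless M \<Longrightarrow> {} \<in> flats M"
  using loopless_on_rk rank_empty by (auto simp: flats_def loopless_on_def)

lemma moebius_flats:
  assumes "{} \<in> flats M" "F \<in> flats M"
  shows "moebius (flats M) {} F = (\<Sum>X \<in> {X \<in> Pow (ground M). flat_closure X = F}. (-1) ^ card X)"
proof (rule moebius_eqI[OF finite_flats assms(1) _ assms(2)])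
  fix F assume F: "F \<in> flats M"
  let ?Y = "{Y \<in> flats M. {} \<le> Y \<and> Y \<le> F}"
  have "F \<subseteq> ground M" using F by (simp add: flats_def)
  then have "finite F" using finite_ground finite_subset by blast
  have "{X \<in> Pow (ground M). flat_closure X = Y} = {X \<in> Pow F. flat_closure X = Y}"
    if "Y \<in> ?Y" for Y
    using that \<open>F \<subseteq> ground M\<close> flat_closure_subset_flat_iff[OF _ F] by auto
  then have "(\<Sum>Y \<in> ?Y. \<Sum>X \<in> {X \<in> Pow (ground M). flat_closure X = Y}. (-1) ^ card X)
      = (\<Sum>Y \<in> ?Y. \<Sum>X \<in> {X \<in> Pow F. flat_closure X = Y}. (-1) ^ card X :: int)" by simp
  also have "\<dots> = (\<Sum>X \<in> Pow F. (-1) ^ card X)"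
  proof (rule sum.group)
    show "flat_closure ` Pow F \<subseteq> ?Y"
    proof (intro image_subsetI)
      fix X assume "X \<in> Pow F"
      then have "X \<subseteq> F" "X \<subseteq> ground M" using \<open>F \<subseteq> ground M\<close> by auto
      then show "flat_closure X \<in> ?Y"
        using flat_closure_in_flats flat_closure_subset_flat_iff[OF _ F] by simp
    qed
  qed (use \<open>finite F\<close> finite_flats in auto)
  also have "\<dots> = (if F = {} then 1 else 0)" using \<open>finite F\<close> by (rule sum_sign_Pow)
  finally show "(\<Sum>Y \<in> ?Y. \<Sum>X \<in> {X \<in> Pow (ground M). flat_closure X = Y}. (-1) ^ card X :: int)
      = (if F = {} then 1 else 0)" .
qed simp

theorem poly_matroid_charpoly:
  assumes "loopless M"
  shows "poly (matroid_charpoly M) x = whitney_sum (rk M) (ground M) x"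
proof -
  let ?E = "ground M"
  let ?C = "\<lambda>F. {X \<in> Pow ?E. flat_closure X = F}"
  have "poly (matroid_charpoly M) x =
      (\<Sum>F \<in> flats M. of_int (moebius (flats M) {} F) * x ^ (rk M ?E - rk M F))"
    using assms by (simp add: matroid_charpoly_def poly_sum poly_monom)
  also have "\<dots> = (\<Sum>F \<in> flats M. \<Sum>X \<in> ?C F. (-1) ^ card X * x ^ (rk M ?E - rk M X))"
  proof (rule sum.cong)
    fix F assume "F \<in> flats M"
    then have "of_int (moebius (flats M) {} F) * x ^ (rk M ?E - rk M F) =
        (\<Sum>X \<in> ?C F. (-1) ^ card X * x ^ (rk M ?E - rk M F))"
      using moebius_flats[OF empty_flat[OF assms]] by (simp add: sum_distrib_right)
    also have "\<dots> = (\<Sum>X \<in> ?C F. (-1) ^ card X * x ^ (rk M ?E - rk M X))"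
      by (rule sum.cong) (auto simp: rk_flat_closure)
    finally show "of_int (moebius (flats M) {} F) * x ^ (rk M ?E - rk M F) = \<dots>" .
  qed simp
  also have "\<dots> = (\<Sum>X \<in> Pow ?E. (-1) ^ card X * x ^ (rk M ?E - rk M X))"
    by (rule sum.group) (use finite_flats finite_ground flat_closure_in_flats in auto)
  finally show ?thesis by (simp add: whitney_sum_def)
qed

end

theorem theorem1p4:
  fixes M :: "'a pre_matroid" and q k :: nat
  assumes "q \<ge> 2" and "k > 0"
    and "matroid M"
    and "tree_width M \<le> int k"
    and "\<not> (\<exists>N. is_minor N M \<and> matroid_iso N (uniform_matroid 2 (2 + q)))"
  shows "matroid_charpoly M = 0 \<or>
    (\<forall>x :: real. x > (real q ^ k - 1) / (real q - 1) \<longrightarrow> poly (matroid_charpoly M) x > 0)"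
proof (cases "loopless M")
  case False
  then show ?thesis by (simp add: matroid_charpoly_def)
next
  case True
  interpret matroid M by fact
  have geometric: "real (\<Sum>i<k. q ^ i) = (real q ^ k - 1) / (real q - 1)"
    using geometric_sum[of "real q" k] assms(1) by simp
  have "poly (matroid_charpoly M) x > 0" if "x > (real q ^ k - 1) / (real q - 1)" for x
    unfolding poly_matroid_charpoly[OF True]
  proof (rule whitney_sum_pos_of_tree_width[OF rank_function_rk finite_ground])
    show "loopless_on (rk M) (ground M)" using True by (rule loopless_on_rk)
    show "tree_width_at_most k (rk M) (ground M)" using assms(4) by (rule tree_width_at_most_rk)
    show "no_uniform_minor 2 (2 + q) (rk M) (ground M)" using assms(5) by (rule no_uniform_minor_rk)
    show "real (\<Sum>i<k. q ^ i) < x" using that by (simp only: geometric)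
  qed
  then show ?thesis by blast
qed

end
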